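(* Let $n\in\mathbb{N}$, $n\ge 1$, and let $S=\{s_1,\dots,s_n\}$ be a linguistic term set with $s_1\prec s_2\prec\dots\prec s_n$. The set of $n$-ICUI granules (with respect to $S$) is in bijection with $L_{2n}$.
   Context: For $m\ge 1$, $L_m=\{(x_1,\dots,x_m)\in[0,1]^m: x_1\le x_2\le\dots\le x_m\}$. $\mathbb{I}$ denotes the set of all closed subintervals $[a,b]$ of $[0,1]$ with $0\le a\le b\le 1$ (degenerate intervals $[a,a]$ allowed). A linguistic term set is a finite totally ordered list of labels. Given a linguistic term set $S=\{s_1,\dots,s_n\}$ with $s_1\prec\dots\prec s_n$, an $n$-dimensional interval (type) cognitive uncertain information ($n$-ICUI) granule is an $n$-tuple $([x_1^-,x_1^+],\dots,[x_n^-,x_n^+])\in\mathbb{I}^n$ such that $[x_n^-,x_n^+]\subseteq\dots\subseteq[x_2^-,x_2^+]\subseteq[x_1^-,x_1^+]\subseteq[0,1]$; the interval $[x_i^-,x_i^+]$ is called the interval with level of acceptance $s_i$. *)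

theory Defs
  imports Complex_Main "HOL-Library.FuncSet"
begin

text \<open>
  An \<open>m\<close>-tuple over a set \<open>A\<close> is an element of \<open>{1..m} \<rightarrow>\<^sub>E A\<close>. The functions are extensional,
  so two tuples are equal iff they agree in the components \<open>1, \<dots>, m\<close>.
\<close>

definition L :: "nat \<Rightarrow> (nat \<Rightarrow> real) set" where
  "L m = {x \<in> {1..m} \<rightarrow>\<^sub>E {0..1}. \<forall>i\<in>{1..<m}. x i \<le> x (Suc i)}"

definition unit_subintervals :: "real set set" where
  "unit_subintervals = {{a..b} | a b. 0 \<le> a \<and> a \<le> b \<and> b \<le> 1}"

definition linguistic_term_set :: "'a set \<Rightarrow> ('a \<times> 'a) set \<Rightarrow> bool" where
  "linguistic_term_set S prec \<longleftrightarrow>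
     finite S \<and> prec \<subseteq> S \<times> S \<and> strict_linear_order_on S prec"

text \<open>
  A granule over \<open>S = {s\<^sub>1 \<prec> \<dots> \<prec> s\<^sub>n}\<close> is an \<open>n\<close>-tuple with \<open>n = card S\<close>; its \<open>i\<close>-th component is
  the interval with level of acceptance \<open>s\<^sub>i\<close>, where \<open>s\<^sub>i\<close> is the \<open>i\<close>-th smallest label. The labels
  enter the definition only through this indexing.
\<close>

definition icui_granules :: "'a set \<Rightarrow> (nat \<Rightarrow> real set) set" where
  "icui_granules S =
     {X \<in> {1..card S} \<rightarrow>\<^sub>E unit_subintervals. \<forall>i\<in>{1..<card S}. X (Suc i) \<subseteq> X i}"

end

theory Submission
  imports Defs
begin

text \<open>
  A nested chain of intervals \<open>[x\<^sub>n\<^sup>-, x\<^sub>n\<^sup>+] \<subseteq> \<dots> \<subseteq> [x\<^sub>1\<^sup>-, x\<^sub>1\<^sup>+]\<close> carries the same information as the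
  chain of its endpoints
  \<open>x\<^sub>1\<^sup>- \<le> \<dots> \<le> x\<^sub>n\<^sup>- \<le> x\<^sub>n\<^sup>+ \<le> \<dots> \<le> x\<^sub>1\<^sup>+\<close>: the left endpoints increase, the right endpoints decrease,
  and the innermost interval links the two halves. So reading off the endpoints from left to right
  gives a point of \<open>L (2 * n)\<close>. Conversely, the \<open>i\<close>-th interval is recovered from a point of
  \<open>L (2 * n)\<close> by pairing its \<open>i\<close>-th coordinate from the left with its \<open>i\<close>-th coordinate from the
  right, that is, with the coordinate of index \<open>2 * n + 1 - i\<close>. Since the intervals are closed and
  nonempty, their endpoints are their infimum and supremum, and the two maps are mutually inverse.
  The strict order makes the labels distinct, so \<open>card S = n\<close> and a granule has \<open>n\<close> components.
\<close>

definition endpoints :: "nat \<Rightarrow> (nat \<Rightarrow> real set) \<Rightarrow> nat \<Rightarrow> real" where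
  "endpoints n X = (\<lambda>j\<in>{1..2 * n}. if j \<le> n then Inf (X j) else Sup (X (2 * n + 1 - j)))"

definition nested_intervals :: "nat \<Rightarrow> (nat \<Rightarrow> real) \<Rightarrow> nat \<Rightarrow> real set" where
  "nested_intervals n x = (\<lambda>i\<in>{1..n}. {x i..x (2 * n + 1 - i)})"

lemma L_mono:
  assumes "x \<in> L m" "1 \<le> i" "i \<le> j" "j \<le> m"
  shows "x i \<le> x j"
  using assms(3,4)
proof (induction j rule: dec_induct)
  case (step k)
  have "x k \<le> x (Suc k)"
    using assms(1,2) step by (auto simp: L_def)
  with step show ?case by simp
qed simp

lemma unit_subinterval_endpoints:
  assumes "I \<in> unit_subintervals"
  shows "I = {Inf I..Sup I}" "0 \<le> Inf I" "Inf I \<le> Sup I" "Sup I \<le> 1"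
  using assms by (auto simp: unit_subintervals_def)

lemma unit_subinterval_subset_iff:
  assumes "I \<in> unit_subintervals" "J \<in> unit_subintervals"
  shows "I \<subseteq> J \<longleftrightarrow> Inf J \<le> Inf I \<and> Sup I \<le> Sup J"
  using assms by (auto simp: unit_subintervals_def)

lemma card_image_strict_order:
  assumes "strict_linear_order_on S prec"
    and "\<And>i j. 1 \<le> i \<Longrightarrow> i < j \<Longrightarrow> j \<le> n \<Longrightarrow> (s i, s j) \<in> prec"
  shows "card (s ` {1..n}) = n"
proof -
  have irr: "irrefl prec"
    using assms(1) by (simp add: strict_linear_order_on_def)
  have "inj_on s {1..n}"
  proof (rule linorder_inj_onI)
    fix i j :: nat
    assume "i < j" "i \<in> {1..n}" "j \<in> {1..n}"
    then have "(s i, s j) \<in> prec" using assms(2) by simp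
    with irr show "s i \<noteq> s j" by (auto simp: irrefl_def)
  qed auto
  then show ?thesis by (simp add: card_image)
qed

lemma endpoints_in_L:
  assumes X: "X \<in> icui_granules S"
  shows "endpoints (card S) X \<in> L (2 * card S)"
proof -
  let ?n = "card S"
  have I: "X i \<in> unit_subintervals" if "i \<in> {1..?n}" for i
    using X that by (auto simp: icui_granules_def)
  have bounds: "0 \<le> Inf (X i)" "Inf (X i) \<le> 1" "0 \<le> Sup (X i)" "Sup (X i) \<le> 1"
    if "i \<in> {1..?n}" for i
    using unit_subinterval_endpoints[OF I[OF that]] by linarith+
  have nested: "Inf (X i) \<le> Inf (X (Suc i))" "Sup (X (Suc i)) \<le> Sup (X i)"
    if "i \<in> {1..<?n}" for i
    using X that unit_subinterval_subset_iff[OF I I, of "Suc i" i]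
    by (auto simp: icui_granules_def)
  have "endpoints ?n X j \<le> endpoints ?n X (Suc j)" if j: "j \<in> {1..<2 * ?n}" for j
  proof -
    consider "j < ?n" | "j = ?n" | "?n < j" by linarith
    then show ?thesis
    proof cases
      case 1
      with j nested(1)[of j] show ?thesis by (simp add: endpoints_def)
    next
      case 2
      \<comment> \<open>The step from the left to the right endpoint of the innermost interval.\<close>
      with j unit_subinterval_endpoints(3)[OF I, of ?n] show ?thesis
        by (simp add: endpoints_def)
    next
      case 3
      define i where "i = 2 * ?n - j"
      have "i \<in> {1..<?n}" "2 * ?n + 1 - j = Suc i" "2 * ?n + 1 - Suc j = i"
        using 3 j by (auto simp: i_def)
      with 3 j nested(2)[of i] show ?thesis by (simp add: endpoints_def)
    qed
  qed
  moreover have "endpoints ?n X \<in> {1..2 * ?n} \<rightarrow>\<^sub>E {0..1}"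
  proof -
    have "2 * ?n + 1 - j \<in> {1..?n}" if "j \<in> {1..2 * ?n}" "\<not> j \<le> ?n" for j
      using that by auto
    with bounds show ?thesis unfolding endpoints_def by (simp add: PiE_iff)
  qed
  ultimately show ?thesis by (simp add: L_def)
qed

lemma nested_intervals_in_granules:
  assumes x: "x \<in> L (2 * card S)"
  shows "nested_intervals (card S) x \<in> icui_granules S"
proof -
  let ?n = "card S"
  have "{x i..x (2 * ?n + 1 - i)} \<in> unit_subintervals" if "i \<in> {1..?n}" for i
  proof -
    have "x i \<le> x (2 * ?n + 1 - i)" using that by (intro L_mono[OF x]) auto
    moreover have "i \<in> {1..2 * ?n}" "2 * ?n + 1 - i \<in> {1..2 * ?n}"
      using that by auto
    then have "x i \<in> {0..1}" "x (2 * ?n + 1 - i) \<in> {0..1}"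
      using x unfolding L_def by blast+
    ultimately show ?thesis by (auto simp: unit_subintervals_def)
  qed
  moreover have "{x (Suc i)..x (2 * ?n + 1 - Suc i)} \<subseteq> {x i..x (2 * ?n + 1 - i)}"
    if "i \<in> {1..<?n}" for i
    using L_mono[OF x, of i "Suc i"] L_mono[OF x, of "2 * ?n + 1 - Suc i" "2 * ?n + 1 - i"] that
    by auto
  ultimately show ?thesis
    by (auto simp: icui_granules_def nested_intervals_def)
qed

lemma nested_intervals_endpoints:
  assumes X: "X \<in> icui_granules S"
  shows "nested_intervals (card S) (endpoints (card S) X) = X"
proof (rule extensionalityI[of _ "{1..card S}"])
  fix i assume i: "i \<in> {1..card S}"
  then have "X i = {Inf (X i)..Sup (X i)}"
    using X by (intro unit_subinterval_endpoints(1)) (auto simp: icui_granules_def)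
  moreover have "2 * card S + 1 - i \<in> {1..2 * card S}" "\<not> 2 * card S + 1 - i \<le> card S"
    "2 * card S + 1 - (2 * card S + 1 - i) = i"
    using i by auto
  ultimately show "nested_intervals (card S) (endpoints (card S) X) i = X i"
    using i by (simp add: nested_intervals_def endpoints_def)
qed (use X in \<open>auto simp: nested_intervals_def icui_granules_def PiE_def\<close>)

text \<open>
  Monotonicity of \<open>x\<close> is needed for every pair \<open>x i \<le> x (2 * n + 1 - i)\<close>: it makes the interval
  between them nonempty, and only then do \<open>Inf\<close> and \<open>Sup\<close> return the two coordinates.
\<close>

lemma endpoints_nested_intervals:
  assumes x: "x \<in> L (2 * n)"
  shows "endpoints n (nested_intervals n x) = x"
proof (rule extensionalityI[of _ "{1..2 * n}"])
  fix j assume j: "j \<in> {1..2 * n}"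
  show "endpoints n (nested_intervals n x) j = x j"
  proof (cases "j \<le> n")
    case True
    with j L_mono[OF x, of j "2 * n + 1 - j"] show ?thesis
      by (simp add: endpoints_def nested_intervals_def)
  next
    case False
    with j L_mono[OF x, of "2 * n + 1 - j" j] show ?thesis
      by (auto simp: endpoints_def nested_intervals_def)
  qed
qed (use x in \<open>auto simp: endpoints_def L_def PiE_def\<close>)

theorem theorem8:
  fixes n :: nat and S :: "'a set" and prec :: "('a \<times> 'a) set" and s :: "nat \<Rightarrow> 'a"
  assumes "n \<ge> 1"
    and "linguistic_term_set S prec"
    and "S = s ` {1..n}"
    and "\<And>i j. 1 \<le> i \<Longrightarrow> i < j \<Longrightarrow> j \<le> n \<Longrightarrow> (s i, s j) \<in> prec"
  shows "\<exists>f. bij_betw f (icui_granules S) (L (2 * n))"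
proof -
  have n: "n = card S"
    using assms(2) card_image_strict_order[of S prec n s, OF _ assms(4)]
    unfolding linguistic_term_set_def assms(3)[symmetric] by simp
  have "bij_betw (endpoints n) (icui_granules S) (L (2 * n))"
    unfolding n
    by (rule bij_betw_byWitness[where f' = "nested_intervals (card S)"])
      (auto simp: nested_intervals_endpoints endpoints_nested_intervals
        endpoints_in_L nested_intervals_in_granules)
  then show ?thesis by blast
qed

end
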